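(* Let $\gamma:D\to\mathbb C^2$ be a local parametrisation of a regular holomorphic curve without inflections and without isotropic points, and let $e$ be its evolute. Then, at every $t\in D$ that is not a vertex of $\gamma$, the tangent line to the evolute at $e(t)$ is the normal line to $\gamma$ at $t$. Consequently, the evolute is the envelope of the family of normal lines of $\gamma$.
   Context: $D\subset\mathbb C$ is a connected and simply connected open set, $\gamma=(z_1,z_2)$ is holomorphic with $\gamma'(t)\neq0$ for all $t$. $\mathbb C^2$ carries the complex bilinear form $\langle v,w\rangle=v_1w_1+v_2w_2$. A point $t$ is isotropic if $\langle\gamma'(t),\gamma'(t)\rangle=0$. In the absence of isotropic points, fix a holomorphic branch of the square root of $z_1'^2+z_2'^2$ on $D$ (shrinking $D$ if necessary). The unit normal is $N=(-z_2',z_1')/(z_1'^2+z_2'^2)^{1/2}$ and the curvature is $\kappa=(z_1'z_2''-z_2'z_1'')/(z_1'^2+z_2'^2)^{3/2}$. An inflection is a point where $\kappa=0$; a vertex is a point where $\kappa'=0$. The normal line to $\gamma$ at $t$ is the complex line through $\gamma(t)$ parallel to $N(t)$, i.e. $\{p\in\mathbb C^2:\langle\gamma(t)-p,\gamma'(t)\rangle=0\}$. The evolute is the curve $e(t)=\gamma(t)+\frac{1}{\kappa(t)}N(t)$, $t\in D$. The envelope of the normal lines is the discriminant of the holomorphic family $G(t,p)=\langle\gamma(t)-p,\gamma'(t)\rangle$, that is, $\{p\in\mathbb C^2:\exists\,t\in D,\ G(t,p)=\frac{\partial G}{\partial t}(t,p)=0\}$. *)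

theory Defs
  imports "HOL-Complex_Analysis.Complex_Analysis"
begin

text \<open>
  The ambient plane is \<^typ>\<open>complex ^ 2\<close>, a complex vector space under \<^const>\<open>vector_scalar_mult\<close>
  (\<open>*s\<close>). The library's \<open>\<bullet>\<close> on this type is the real inner product, so the complex bilinear
  (not Hermitian) form is introduced separately.
\<close>

definition cbilin :: "complex ^ 2 \<Rightarrow> complex ^ 2 \<Rightarrow> complex" where
  "cbilin v w = v $ 1 * w $ 1 + v $ 2 * w $ 2"

definition curve_holomorphic_on :: "(complex \<Rightarrow> complex ^ 2) \<Rightarrow> complex set \<Rightarrow> bool" where
  "curve_holomorphic_on \<gamma> D \<longleftrightarrow> (\<forall>i. (\<lambda>t. \<gamma> t $ i) holomorphic_on D)"

definition curve_deriv :: "(complex \<Rightarrow> complex ^ 2) \<Rightarrow> complex \<Rightarrow> complex ^ 2" where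
  "curve_deriv \<gamma> t = (\<chi> i. deriv (\<lambda>u. \<gamma> u $ i) t)"

definition regular_curve_on :: "(complex \<Rightarrow> complex ^ 2) \<Rightarrow> complex set \<Rightarrow> bool" where
  "regular_curve_on \<gamma> D \<longleftrightarrow>
     curve_holomorphic_on \<gamma> D \<and> (\<forall>t\<in>D. curve_deriv \<gamma> t \<noteq> 0)"

definition isotropic :: "(complex \<Rightarrow> complex ^ 2) \<Rightarrow> complex \<Rightarrow> bool" where
  "isotropic \<gamma> t \<longleftrightarrow> cbilin (curve_deriv \<gamma> t) (curve_deriv \<gamma> t) = 0"

text \<open>
  The function \<open>s\<close> below is the fixed branch of \<open>(z\<^sub>1'\<^sup>2 + z\<^sub>2'\<^sup>2)\<^sup>1\<^sup>/\<^sup>2\<close>. Normal, curvature and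
  evolute take it as a parameter; the power \<open>3/2\<close> is \<open>s\<^sup>3\<close>.
\<close>

definition speed_branch :: "(complex \<Rightarrow> complex ^ 2) \<Rightarrow> complex set \<Rightarrow> (complex \<Rightarrow> complex) \<Rightarrow> bool" where
  "speed_branch \<gamma> D s \<longleftrightarrow>
     s holomorphic_on D \<and> (\<forall>t\<in>D. (s t)\<^sup>2 = cbilin (curve_deriv \<gamma> t) (curve_deriv \<gamma> t))"

definition unit_normal :: "(complex \<Rightarrow> complex ^ 2) \<Rightarrow> (complex \<Rightarrow> complex) \<Rightarrow> complex \<Rightarrow> complex ^ 2" where
  "unit_normal \<gamma> s t =
     (1 / s t) *s vector [- (curve_deriv \<gamma> t $ 2), curve_deriv \<gamma> t $ 1]"

definition curvature :: "(complex \<Rightarrow> complex ^ 2) \<Rightarrow> (complex \<Rightarrow> complex) \<Rightarrow> complex \<Rightarrow> complex" where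
  "curvature \<gamma> s t =
     (let \<gamma>' = curve_deriv \<gamma> t; \<gamma>'' = curve_deriv (curve_deriv \<gamma>) t
      in (\<gamma>' $ 1 * \<gamma>'' $ 2 - \<gamma>' $ 2 * \<gamma>'' $ 1) / (s t) ^ 3)"

definition inflection :: "(complex \<Rightarrow> complex ^ 2) \<Rightarrow> (complex \<Rightarrow> complex) \<Rightarrow> complex \<Rightarrow> bool" where
  "inflection \<gamma> s t \<longleftrightarrow> curvature \<gamma> s t = 0"

definition vertex :: "(complex \<Rightarrow> complex ^ 2) \<Rightarrow> (complex \<Rightarrow> complex) \<Rightarrow> complex \<Rightarrow> bool" where
  "vertex \<gamma> s t \<longleftrightarrow> deriv (curvature \<gamma> s) t = 0"

definition evolute :: "(complex \<Rightarrow> complex ^ 2) \<Rightarrow> (complex \<Rightarrow> complex) \<Rightarrow> complex \<Rightarrow> complex ^ 2" where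
  "evolute \<gamma> s t = \<gamma> t + (1 / curvature \<gamma> s t) *s unit_normal \<gamma> s t"

definition line_through :: "complex ^ 2 \<Rightarrow> complex ^ 2 \<Rightarrow> (complex ^ 2) set" where
  "line_through p v = {p + c *s v | c. True}"

definition normal_line :: "(complex \<Rightarrow> complex ^ 2) \<Rightarrow> (complex \<Rightarrow> complex) \<Rightarrow> complex \<Rightarrow> (complex ^ 2) set" where
  "normal_line \<gamma> s t = line_through (\<gamma> t) (unit_normal \<gamma> s t)"

text \<open>A complex line only where \<open>curve_deriv \<alpha> t \<noteq> 0\<close>; otherwise it degenerates to a point.\<close>

definition tangent_line :: "(complex \<Rightarrow> complex ^ 2) \<Rightarrow> complex \<Rightarrow> (complex ^ 2) set" where
  "tangent_line \<alpha> t = line_through (\<alpha> t) (curve_deriv \<alpha> t)"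

definition normal_family :: "(complex \<Rightarrow> complex ^ 2) \<Rightarrow> complex \<Rightarrow> complex ^ 2 \<Rightarrow> complex" where
  "normal_family \<gamma> t p = cbilin (\<gamma> t - p) (curve_deriv \<gamma> t)"

definition discriminant :: "complex set \<Rightarrow> (complex \<Rightarrow> complex ^ 2 \<Rightarrow> complex) \<Rightarrow> (complex ^ 2) set" where
  "discriminant D G = {p. \<exists>t\<in>D. G t p = 0 \<and> deriv (\<lambda>u. G u p) t = 0}"

definition normal_envelope :: "(complex \<Rightarrow> complex ^ 2) \<Rightarrow> complex set \<Rightarrow> (complex ^ 2) set" where
  "normal_envelope \<gamma> D = discriminant D (normal_family \<gamma>)"

text \<open>The zero sets of \<^const>\<open>normal_family\<close> are the normal lines.\<close>

lemma normal_line_eq_zero_set: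
  assumes "speed_branch \<gamma> D s" "t \<in> D" "\<not> isotropic \<gamma> t"
  shows "normal_line \<gamma> s t = {p. normal_family \<gamma> t p = 0}"
proof -
  define a where "a = curve_deriv \<gamma> t $ 1"
  define b where "b = curve_deriv \<gamma> t $ 2"
  have s2: "(s t)\<^sup>2 = a * a + b * b" and nz: "a * a + b * b \<noteq> 0"
    using assms by (auto simp: speed_branch_def isotropic_def cbilin_def a_def b_def)
  then have s0: "s t \<noteq> 0" by auto
  show ?thesis
  proof (intro set_eqI iffI)
    fix p assume "p \<in> normal_line \<gamma> s t"
    then show "p \<in> {p. normal_family \<gamma> t p = 0}"
      by (auto simp: normal_line_def line_through_def normal_family_def cbilin_def unit_normal_def)
  next
    fix p assume "p \<in> {p. normal_family \<gamma> t p = 0}"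
    then have G: "(\<gamma> t $ 1 - p $ 1) * a + (\<gamma> t $ 2 - p $ 2) * b = 0"
      by (simp add: normal_family_def cbilin_def a_def b_def)
    define k where "k = ((p $ 2 - \<gamma> t $ 2) * a - (p $ 1 - \<gamma> t $ 1) * b) / (a * a + b * b)"
    have "p $ 1 - \<gamma> t $ 1 = - (k * b)"
    proof -
      have "(p $ 1 - \<gamma> t $ 1) * (a * a + b * b)
          + ((p $ 2 - \<gamma> t $ 2) * a - (p $ 1 - \<gamma> t $ 1) * b) * b
          = - (((\<gamma> t $ 1 - p $ 1) * a + (\<gamma> t $ 2 - p $ 2) * b) * a)"
        by (simp add: algebra_simps)
      then show ?thesis using nz unfolding G k_def
        by (simp add: eq_divide_eq eq_neg_iff_add_eq_0 add_divide_eq_iff)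
    qed
    then have 1: "p $ 1 = \<gamma> t $ 1 - k * b" by (simp add: algebra_simps)
    have "p $ 2 - \<gamma> t $ 2 = k * a"
    proof -
      have "(p $ 2 - \<gamma> t $ 2) * (a * a + b * b)
          - ((p $ 2 - \<gamma> t $ 2) * a - (p $ 1 - \<gamma> t $ 1) * b) * a
          = - (((\<gamma> t $ 1 - p $ 1) * a + (\<gamma> t $ 2 - p $ 2) * b) * b)"
        by (simp add: algebra_simps)
      then show ?thesis using nz unfolding G k_def
        by (simp add: eq_divide_eq)
    qed
    then have 2: "p $ 2 = \<gamma> t $ 2 + k * a" by (simp add: algebra_simps)
    have "p = \<gamma> t + (k * s t) *s unit_normal \<gamma> s t"
      using s0 by (simp add: vec_eq_iff forall_2 unit_normal_def 1 2 a_def b_def)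
    then show "p \<in> normal_line \<gamma> s t"
      by (auto simp: normal_line_def line_through_def)
  qed
qed

end

theory Submission imports Defs begin

text \<open>
  The proof is the complex analogue of the Frenet computation for real plane curves. Differentiating
  \<open>s\<^sup>2 = \<langle>\<gamma>', \<gamma>'\<rangle>\<close> gives \<open>s s' = \<langle>\<gamma>', \<gamma>''\<rangle>\<close>, and from this the Frenet equation
  \<open>N' = - \<kappa> \<gamma>'\<close> follows by algebra (\<open>unit_normal_has_derivative\<close>). In
  \<open>e = \<gamma> + (1/\<kappa>) N\<close> the two tangential contributions to \<open>e'\<close> therefore cancel, which leaves
  \<open>e' = - (\<kappa>'/\<kappa>\<^sup>2) N\<close> (\<open>curve_deriv_evolute\<close>). Away from vertices this is a nonzero multiple
  of \<open>N\<close>, and \<open>e t\<close> lies on the normal line at \<open>t\<close>, so the tangent line of \<open>e\<close> is that normal line.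

  For the envelope, \<open>G t p = 0\<close> says that \<open>p = \<gamma> t + c N t\<close> for some \<open>c\<close>. At such a point
  \<open>\<partial>G/\<partial>t = \<langle>\<gamma>', \<gamma>'\<rangle> + \<langle>\<gamma> - p, \<gamma>''\<rangle> = s\<^sup>2 (1 - c \<kappa>)\<close> (\<open>deriv_normal_family\<close>), which vanishes exactly
  for \<open>c = 1/\<kappa>\<close>, that is, for \<open>p = e t\<close>. This argument is pointwise in \<open>t\<close>, so the envelope contains
  the evolute points of the vertices as well, even though \<open>e\<close> is singular there.
\<close>

lemma curve_has_field_derivative:
  assumes "curve_holomorphic_on \<gamma> D" "open D" "t \<in> D"
  shows "((\<lambda>u. \<gamma> u $ i) has_field_derivative curve_deriv \<gamma> t $ i) (at t)"
  using assms by (auto simp: curve_holomorphic_on_def curve_deriv_def intro: holomorphic_derivI)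

lemma curve_holomorphic_on_curve_deriv:
  assumes "curve_holomorphic_on \<gamma> D" "open D"
  shows "curve_holomorphic_on (curve_deriv \<gamma>) D"
  using assms by (auto simp: curve_holomorphic_on_def curve_deriv_def intro: holomorphic_deriv)

lemma curve_deriv_eqI:
  fixes \<alpha> :: "complex \<Rightarrow> complex ^ 2"
  assumes "\<And>i. ((\<lambda>u. \<alpha> u $ i) has_field_derivative v $ i) (at t)"
  shows "curve_deriv \<alpha> t = v"
  using assms by (simp add: curve_deriv_def vec_eq_iff DERIV_imp_deriv)

lemma speed_branch_nonzero:
  assumes "speed_branch \<gamma> D s" "t \<in> D" "\<not> isotropic \<gamma> t"
  shows "s t \<noteq> 0"
  using assms by (auto simp: speed_branch_def isotropic_def)

text \<open>
  The derivative of the square root is never computed from a formula for the branch; both sides of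
  \<open>s\<^sup>2 = \<langle>\<gamma>', \<gamma>'\<rangle>\<close> are differentiated instead, so the identity holds for either branch.
\<close>

lemma speed_branch_deriv:
  assumes "curve_holomorphic_on \<gamma> D" "open D" "speed_branch \<gamma> D s" "t \<in> D"
  shows "s t * deriv s t = cbilin (curve_deriv \<gamma> t) (curve_deriv (curve_deriv \<gamma>) t)"
proof -
  note d = curve_has_field_derivative[OF curve_holomorphic_on_curve_deriv[OF assms(1,2)] assms(2,4)]
  have "(s has_field_derivative deriv s t) (at t)"
    using assms by (auto simp: speed_branch_def intro: holomorphic_derivI)
  then have "((\<lambda>u. (s u)\<^sup>2) has_field_derivative 2 * (s t * deriv s t)) (at t)"
    by (auto intro!: derivative_eq_intros)
  then have "((\<lambda>u. cbilin (curve_deriv \<gamma> u) (curve_deriv \<gamma> u))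
      has_field_derivative 2 * (s t * deriv s t)) (at t)"
    by (rule has_field_derivative_transform_within_open[OF _ assms(2,4)])
      (use assms(3) in \<open>auto simp: speed_branch_def\<close>)
  moreover have "((\<lambda>u. cbilin (curve_deriv \<gamma> u) (curve_deriv \<gamma> u)) has_field_derivative
      2 * cbilin (curve_deriv \<gamma> t) (curve_deriv (curve_deriv \<gamma>) t)) (at t)"
    unfolding cbilin_def
    by (rule derivative_eq_intros d refl)+ (simp add: algebra_simps)
  ultimately have "2 * (s t * deriv s t)
      = 2 * cbilin (curve_deriv \<gamma> t) (curve_deriv (curve_deriv \<gamma>) t)"
    by (rule DERIV_unique)
  then show ?thesis by simp
qed

text \<open>
  The Frenet equation \<open>N' = - \<kappa> \<gamma>'\<close>. It holds because \<open>\<langle>N, N\<rangle> = 1\<close> makes \<open>N'\<close> orthogonal to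
  \<open>N\<close>, hence tangential; the computation below identifies the factor.
\<close>

lemma unit_normal_has_derivative:
  assumes "curve_holomorphic_on \<gamma> D" "open D" "speed_branch \<gamma> D s" "t \<in> D" "\<not> isotropic \<gamma> t"
  shows "((\<lambda>u. unit_normal \<gamma> s u $ i) has_field_derivative
           - (curvature \<gamma> s t * curve_deriv \<gamma> t $ i)) (at t)"
proof -
  define a b where "a = curve_deriv \<gamma> t $ 1" and "b = curve_deriv \<gamma> t $ 2"
  define a' b' where "a' = curve_deriv (curve_deriv \<gamma>) t $ 1"
    and "b' = curve_deriv (curve_deriv \<gamma>) t $ 2"
  note d = curve_has_field_derivative[OF curve_holomorphic_on_curve_deriv[OF assms(1,2)] assms(2,4)]
  have ds: "(s has_field_derivative deriv s t) (at t)"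
    using assms by (auto simp: speed_branch_def intro: holomorphic_derivI)
  have s0: "s t \<noteq> 0" using assms by (intro speed_branch_nonzero)
  have s2: "(s t)\<^sup>2 = a * a + b * b"
    using assms by (simp add: speed_branch_def cbilin_def a_def b_def)
  have ss': "s t * deriv s t = a * a' + b * b'"
    using speed_branch_deriv[OF assms(1-4)] by (simp add: cbilin_def a_def b_def a'_def b'_def)
  have \<kappa>: "curvature \<gamma> s t = (a * b' - b * a') / s t ^ 3"
    by (simp add: curvature_def Let_def a_def b_def a'_def b'_def)
  \<comment> \<open>Expanding the quotient rule by \<open>s\<close> gives the denominator \<open>s\<^sup>3\<close> of \<open>\<kappa>\<close> and turns \<open>s'\<close> into
      \<open>s s'\<close>, which is polynomial in the derivatives of \<open>\<gamma>\<close>.\<close>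
  have quot: "(x' * s t - x * deriv s t) / (s t * s t)
      = (x' * (a * a + b * b) - x * (a * a' + b * b')) / s t ^ 3" for x x'
    using s0 unfolding s2[symmetric] ss'[symmetric]
    by (simp add: field_simps power2_eq_square power3_eq_cube)
  have "((\<lambda>u. - curve_deriv \<gamma> u $ 2 / s u) has_field_derivative - (curvature \<gamma> s t * a)) (at t)"
    apply (rule derivative_eq_intros d ds refl s0)+
    unfolding a_def[symmetric] b_def[symmetric] a'_def[symmetric] b'_def[symmetric] quot \<kappa>
    using s0 by (simp add: field_simps)
  moreover have "((\<lambda>u. curve_deriv \<gamma> u $ 1 / s u) has_field_derivative - (curvature \<gamma> s t * b)) (at t)"
    apply (rule derivative_eq_intros d ds refl s0)+
    unfolding a_def[symmetric] b_def[symmetric] a'_def[symmetric] b'_def[symmetric] quot \<kappa>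
    using s0 by (simp add: field_simps)
  ultimately show ?thesis
    using exhaust_2[of i] by (auto simp: unit_normal_def a_def b_def)
qed

lemma curvature_holomorphic_on:
  assumes "curve_holomorphic_on \<gamma> D" "open D" "speed_branch \<gamma> D s" "\<forall>t\<in>D. \<not> isotropic \<gamma> t"
  shows "curvature \<gamma> s holomorphic_on D"
proof -
  have "curve_holomorphic_on (curve_deriv \<gamma>) D"
    and "curve_holomorphic_on (curve_deriv (curve_deriv \<gamma>)) D"
    using assms by (auto intro: curve_holomorphic_on_curve_deriv)
  moreover have "s holomorphic_on D" "\<And>t. t \<in> D \<Longrightarrow> s t \<noteq> 0"
    using assms speed_branch_nonzero by (auto simp: speed_branch_def)
  ultimately show ?thesis
    unfolding curvature_def Let_def curve_holomorphic_on_def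
    by (intro holomorphic_intros) auto
qed

text \<open>
  With the Frenet equation, \<open>(1/\<kappa>) N' = - \<gamma>'\<close> cancels the velocity of the curve, and only the
  derivative of the radius of curvature \<open>1/\<kappa>\<close> survives.
\<close>

lemma curve_deriv_evolute:
  assumes "curve_holomorphic_on \<gamma> D" "open D" "speed_branch \<gamma> D s" "\<forall>t\<in>D. \<not> isotropic \<gamma> t"
    and "t \<in> D" "\<not> inflection \<gamma> s t"
  shows "curve_deriv (evolute \<gamma> s) t
    = (- deriv (curvature \<gamma> s) t / (curvature \<gamma> s t)\<^sup>2) *s unit_normal \<gamma> s t"
proof (rule curve_deriv_eqI)
  fix i
  have \<kappa>0: "curvature \<gamma> s t \<noteq> 0" using assms by (simp add: inflection_def)
  have d\<kappa>: "(curvature \<gamma> s has_field_derivative deriv (curvature \<gamma> s) t) (at t)"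
    using curvature_holomorphic_on[OF assms(1-4)] assms by (auto intro: holomorphic_derivI)
  have dN: "((\<lambda>u. unit_normal \<gamma> s u $ i) has_field_derivative
           - (curvature \<gamma> s t * curve_deriv \<gamma> t $ i)) (at t)"
    using assms by (intro unit_normal_has_derivative) auto
  note d\<gamma> = curve_has_field_derivative[OF assms(1,2,5), of i]
  have "((\<lambda>u. \<gamma> u $ i + 1 / curvature \<gamma> s u * unit_normal \<gamma> s u $ i) has_field_derivative
      (- deriv (curvature \<gamma> s) t / (curvature \<gamma> s t)\<^sup>2) * unit_normal \<gamma> s t $ i) (at t)"
    by (rule derivative_eq_intros d\<gamma> d\<kappa> dN refl \<kappa>0)+
      (use \<kappa>0 in \<open>simp add: power2_eq_square\<close>)
  then show "((\<lambda>u. evolute \<gamma> s u $ i) has_field_derivative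
      ((- deriv (curvature \<gamma> s) t / (curvature \<gamma> s t)\<^sup>2) *s unit_normal \<gamma> s t) $ i) (at t)"
    by (simp add: evolute_def)
qed

lemma unit_normal_nonzero:
  assumes "speed_branch \<gamma> D s" "t \<in> D" "\<not> isotropic \<gamma> t"
  shows "unit_normal \<gamma> s t \<noteq> 0"
proof
  assume "unit_normal \<gamma> s t = 0"
  then have "curve_deriv \<gamma> t $ 1 = 0" "curve_deriv \<gamma> t $ 2 = 0"
    using speed_branch_nonzero[OF assms] by (auto simp: unit_normal_def vec_eq_iff forall_2)
  then show False using assms(3) by (simp add: isotropic_def cbilin_def)
qed

text \<open>
  The tangent line of the evolute is based at \<open>e t\<close> with direction \<open>e' t\<close>, the normal line at \<open>\<gamma> t\<close>
  with direction \<open>N t\<close>; this lemma identifies the two descriptions.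
\<close>

lemma line_through_shift_scale:
  assumes "k \<noteq> 0"
  shows "line_through (p + r *s v) (k *s v) = line_through p v"
proof -
  have "\<exists>d. p + r *s v + c *s (k *s v) = p + d *s v" for c
    by (rule exI[of _ "r + c * k"]) (simp add: vec_eq_iff algebra_simps)
  moreover have "\<exists>d. p + c *s v = p + r *s v + d *s (k *s v)" for c
    using assms by (intro exI[of _ "(c - r) / k"]) (simp add: vec_eq_iff field_simps)
  ultimately show ?thesis unfolding line_through_def by auto
qed

text \<open>
  The point is held fixed while the parameter of the normal moves. Restricted to the normal line at
  \<open>t\<close>, the \<open>t\<close>-derivative of the family is an affine function of the position \<open>c\<close> on that line, and
  if \<open>\<kappa>\<close> does not vanish, its only zero is the centre of curvature.
\<close>

lemma deriv_normal_family:
  assumes "curve_holomorphic_on \<gamma> D" "open D" "speed_branch \<gamma> D s" "t \<in> D" "\<not> isotropic \<gamma> t"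
  shows "deriv (\<lambda>u. normal_family \<gamma> u (\<gamma> t + c *s unit_normal \<gamma> s t)) t
    = (s t)\<^sup>2 * (1 - c * curvature \<gamma> s t)"
proof -
  note d\<gamma> = curve_has_field_derivative[OF assms(1,2,4)]
  note d\<gamma>' = curve_has_field_derivative[OF curve_holomorphic_on_curve_deriv[OF assms(1,2)] assms(2,4)]
  have s0: "s t \<noteq> 0" using assms by (intro speed_branch_nonzero)
  define p where "p = \<gamma> t + c *s unit_normal \<gamma> s t"
  have "((\<lambda>u. normal_family \<gamma> u p) has_field_derivative
      cbilin (curve_deriv \<gamma> t) (curve_deriv \<gamma> t)
      + cbilin (\<gamma> t - p) (curve_deriv (curve_deriv \<gamma>) t)) (at t)"
    unfolding normal_family_def cbilin_def vector_minus_component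
    by (rule derivative_eq_intros d\<gamma> d\<gamma>' refl)+ (simp add: algebra_simps)
  moreover have "cbilin (curve_deriv \<gamma> t) (curve_deriv \<gamma> t) = (s t)\<^sup>2"
    using assms by (simp add: speed_branch_def)
  moreover have "cbilin (\<gamma> t - p) (curve_deriv (curve_deriv \<gamma>) t) = - c * ((s t)\<^sup>2 * curvature \<gamma> s t)"
    using s0 by (simp add: cbilin_def p_def unit_normal_def curvature_def Let_def field_simps
        power2_eq_square power3_eq_cube)
  ultimately show ?thesis
    unfolding p_def by (simp add: DERIV_imp_deriv algebra_simps)
qed

theorem corollary3p13:
  fixes D :: "complex set" and \<gamma> :: "complex \<Rightarrow> complex ^ 2" and s :: "complex \<Rightarrow> complex"
  assumes "open D" and "connected D" and "simply_connected D"
    and "regular_curve_on \<gamma> D"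
    and "\<forall>t\<in>D. \<not> isotropic \<gamma> t"
    and "speed_branch \<gamma> D s"
    and "\<forall>t\<in>D. \<not> inflection \<gamma> s t"
  shows "(\<forall>t\<in>D. \<not> vertex \<gamma> s t \<longrightarrow>
            curve_deriv (evolute \<gamma> s) t \<noteq> 0 \<and>
            tangent_line (evolute \<gamma> s) t = normal_line \<gamma> s t) \<and>
         evolute \<gamma> s ` D = normal_envelope \<gamma> D"
proof (intro conjI ballI impI)
  have hol: "curve_holomorphic_on \<gamma> D"
    using assms by (simp add: regular_curve_on_def)
  fix t assume t: "t \<in> D" "\<not> vertex \<gamma> s t"
  define k where "k = - deriv (curvature \<gamma> s) t / (curvature \<gamma> s t)\<^sup>2"
  have k: "k \<noteq> 0"
    using assms t by (auto simp: k_def vertex_def inflection_def)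
  have e': "curve_deriv (evolute \<gamma> s) t = k *s unit_normal \<gamma> s t"
    unfolding k_def using assms t hol by (intro curve_deriv_evolute) auto
  show "curve_deriv (evolute \<gamma> s) t \<noteq> 0"
    using e' k unit_normal_nonzero assms t by (auto simp: vec_eq_iff)
  show "tangent_line (evolute \<gamma> s) t = normal_line \<gamma> s t"
    unfolding tangent_line_def normal_line_def e'
    by (simp add: evolute_def line_through_shift_scale[OF k])
next
  have hol: "curve_holomorphic_on \<gamma> D"
    using assms by (simp add: regular_curve_on_def)
  have "normal_family \<gamma> t p = 0 \<and> deriv (\<lambda>u. normal_family \<gamma> u p) t = 0 \<longleftrightarrow> p = evolute \<gamma> s t"
    if t: "t \<in> D" for t p
  proof -
    have iso: "\<not> isotropic \<gamma> t" and \<kappa>0: "curvature \<gamma> s t \<noteq> 0"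
      using assms t by (auto simp: inflection_def)
    have s0: "s t \<noteq> 0" using assms t by (intro speed_branch_nonzero) auto
    have on_normal: "normal_family \<gamma> t p = 0 \<longleftrightarrow> (\<exists>c. p = \<gamma> t + c *s unit_normal \<gamma> s t)"
      using normal_line_eq_zero_set[OF assms(6) t iso]
      by (auto simp: normal_line_def line_through_def set_eq_iff)
    have centre: "deriv (\<lambda>u. normal_family \<gamma> u (\<gamma> t + c *s unit_normal \<gamma> s t)) t = 0
        \<longleftrightarrow> c = 1 / curvature \<gamma> s t" for c
      using s0 \<kappa>0 unfolding deriv_normal_family[OF hol assms(1) assms(6) t iso]
      by (auto simp: field_simps)
    show ?thesis
      unfolding on_normal evolute_def by (metis centre)
  qed
  then show "evolute \<gamma> s ` D = normal_envelope \<gamma> D"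
    unfolding normal_envelope_def discriminant_def by auto
qed

end
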